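(* For every integer $n\ge 1$ and every $k=1,2,\dots,n$, $$g_{2n,k} = (-1)^n L\left(s^{n+1-k}F_{2k-1}(s)\right),$$ and for every integer $n\ge 0$ and every $k=1,2,\dots,n+1$, $$g_{2n+1,k} = (-1)^n L\left(s^{n+1-k}F_{2k}(s)\right).$$
   Context: The Fibonacci polynomials $F_n(s)$ are defined by $F_0(s)=0$, $F_1(s)=1$ and $F_n(s)=F_{n-1}(s)+sF_{n-2}(s)$ for $n\ge 2$. Since $F_{2k+1}(s)$ has degree $k$, the polynomials $F_{2k+1}(s)$, $k\ge 0$, form a basis of $\mathbb{C}[s]$, and $L$ denotes the linear functional on $\mathbb{C}[s]$ determined by $L(F_1(s))=1$ and $L(F_{2k+1}(s))=0$ for all $k\ge 1$. The Seidel triangle for the Genocchi numbers is the array of integers $(g_{i,j})_{i\ge 1}$ such that $g_{1,1}=g_{2,1}=1$, $g_{i,j}=0$ if $j\le 0$ or $j>\lceil i/2\rceil$, and, for $i\ge 1$, $g_{2i+1,j}=g_{2i+1,j-1}+g_{2i,j}$ for $j=1,2,\dots,i+1$ and $g_{2i,j}=g_{2i,j+1}+g_{2i-1,j}$ for $j=i,i-1,\dots,1$. *)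

theory Defs
  imports Complex_Main "HOL-Computational_Algebra.Polynomial"
begin

fun fib_poly :: "nat \<Rightarrow> complex poly" where
  "fib_poly 0 = 0"
| "fib_poly (Suc 0) = 1"
| "fib_poly (Suc (Suc n)) = fib_poly (Suc n) + [:0, 1:] * fib_poly n"

definition is_fib_functional :: "(complex poly \<Rightarrow> complex) \<Rightarrow> bool" where
  "is_fib_functional L \<longleftrightarrow>
     Vector_Spaces.linear smult (*) L \<and>
     L (fib_poly 1) = 1 \<and> (\<forall>k\<ge>1. L (fib_poly (2 * k + 1)) = 0)"

text \<open>The column index is an integer, so that the vanishing condition for \<open>j \<le> 0\<close> can be
  imposed as it stands. The entries with \<open>i = 0\<close> do not belong to the triangle and are
  left unconstrained.\<close>

definition is_seidel_genocchi :: "(nat \<Rightarrow> int \<Rightarrow> int) \<Rightarrow> bool" where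
  "is_seidel_genocchi g \<longleftrightarrow>
     g 1 1 = 1 \<and> g 2 1 = 1 \<and>
     (\<forall>i\<ge>1. \<forall>j. j \<le> 0 \<or> j > \<lceil>real i / 2\<rceil> \<longrightarrow> g i j = 0) \<and>
     (\<forall>i\<ge>1. \<forall>j\<in>{1..int i + 1}. g (2 * i + 1) j = g (2 * i + 1) (j - 1) + g (2 * i) j) \<and>
     (\<forall>i\<ge>1. \<forall>j\<in>{1..int i}. g (2 * i) j = g (2 * i) (j + 1) + g (2 * i - 1) j)"

text \<open>Both objects exist, and they are unique (for the triangle, on the rows \<open>i \<ge> 1\<close>).\<close>

lemma linear_functional_iff:
  "Vector_Spaces.linear smult (*) (L :: complex poly \<Rightarrow> complex) \<longleftrightarrow>
     (\<forall>p q. L (p + q) = L p + L q) \<and> (\<forall>c p. L (smult c p) = c * L p)"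
proof -
  have "vector_space (smult :: complex \<Rightarrow> complex poly \<Rightarrow> complex poly)"
    by unfold_locales (auto simp: smult_add_right smult_add_left)
  moreover have "vector_space ((*) :: complex \<Rightarrow> complex \<Rightarrow> complex)"
    by unfold_locales (auto simp: algebra_simps)
  ultimately show ?thesis
    by (auto simp: Vector_Spaces.linear_def module_hom_def module_hom_axioms_def
        vector_space_def module_def)
qed

lemma fib_poly_degree:
  "degree (fib_poly (2 * k + 1)) \<le> k \<and> coeff (fib_poly (2 * k + 1)) k = 1 \<and>
   degree (fib_poly (2 * k + 2)) \<le> k"
proof (induction k)
  case 0
  show ?case by (simp add: numeral_2_eq_2)
next
  case (Suc k)
  define a b where "a = fib_poly (2 * k + 1)" and "b = fib_poly (2 * k + 2)"
  have 1: "fib_poly (2 * Suc k + 1) = b + pCons 0 a"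
    by (simp add: a_def b_def)
  have 2: "fib_poly (2 * Suc k + 2) = (b + pCons 0 a) + pCons 0 b"
    using 1 by (simp add: b_def)
  have *: "degree a \<le> k" "coeff a k = 1" "degree b \<le> k"
    using Suc by (auto simp: a_def b_def)
  have d: "degree (pCons 0 a) \<le> Suc k" "degree (pCons 0 b) \<le> Suc k" "degree b \<le> Suc k"
    using * degree_pCons_le[of 0 a] degree_pCons_le[of 0 b] by linarith+
  have d1: "degree (b + pCons 0 a) \<le> Suc k"
    by (rule degree_add_le[OF d(3) d(1)])
  have "degree (b + pCons 0 a + pCons 0 b) \<le> Suc k"
    by (rule degree_add_le[OF d1 d(2)])
  moreover have "coeff (b + pCons 0 a) (Suc k) = 1"
    using * by (simp add: coeff_eq_0)
  ultimately show ?case unfolding 1 2 using d1 by blast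
qed

function fib_moment :: "nat \<Rightarrow> complex" where
  "fib_moment k = (if k = 0 then 1
     else - (\<Sum>i<k. coeff (fib_poly (2 * k + 1)) i * fib_moment i))"
  by auto
termination by (relation "measure id") auto

declare fib_moment.simps [simp del]

lemma linear_functional_eq_sum:
  assumes "Vector_Spaces.linear smult (*) (L :: complex poly \<Rightarrow> complex)" "degree p \<le> n"
  shows "L p = (\<Sum>i\<le>n. coeff p i * L (monom 1 i))"
proof -
  have L: "\<And>p q. L (p + q) = L p + L q" "\<And>c p. L (smult c p) = c * L p"
    using assms(1) by (auto simp: linear_functional_iff)
  have L0: "L 0 = 0" using L(2)[of 0 0] by simp
  have S: "L (\<Sum>i\<in>A. f i) = (\<Sum>i\<in>A. L (f i))" if "finite A" for A and f :: "nat \<Rightarrow> complex poly"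
    using that by (induction A rule: finite_induct) (auto simp: L L0)
  have "p = (\<Sum>i\<le>n. monom (coeff p i) i)"
    using poly_as_sum_of_monoms'[OF assms(2)] by simp
  also have "\<dots> = (\<Sum>i\<le>n. smult (coeff p i) (monom 1 i))"
    by (simp add: smult_monom)
  finally have "L p = L (\<Sum>i\<le>n. smult (coeff p i) (monom 1 i))" by simp
  then show ?thesis by (simp add: S L)
qed

lemma ex1_fib_functional: "\<exists>!L. is_fib_functional L"
proof (rule ex_ex1I)
  define L where "L p = (\<Sum>i\<le>degree p. coeff p i * fib_moment i)" for p
  have L: "L p = (\<Sum>i\<le>n. coeff p i * fib_moment i)" if "degree p \<le> n" for p n
    unfolding L_def by (rule sum.mono_neutral_left) (use that in \<open>auto simp: coeff_eq_0\<close>)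
  have "L (p + q) = L p + L q" for p q
  proof -
    define n where "n = max (degree p) (degree q)"
    have "degree (p + q) \<le> n" "degree p \<le> n" "degree q \<le> n"
      by (auto simp: n_def intro: degree_add_le)
    then show ?thesis by (simp add: L[of _ n] sum.distrib distrib_right)
  qed
  moreover have "L (smult c p) = c * L p" for c p
    using L[of "smult c p" "degree p"] L[of p "degree p"] degree_smult_le[of c p]
    by (simp add: sum_distrib_left mult.assoc)
  ultimately have "Vector_Spaces.linear smult (*) L"
    by (simp add: linear_functional_iff)
  moreover have "L (fib_poly 1) = 1" by (simp add: L_def fib_moment.simps[of 0])
  moreover have "L (fib_poly (2 * k + 1)) = 0" if "k \<ge> 1" for k
  proof -
    have "L (fib_poly (2 * k + 1)) = (\<Sum>i\<le>k. coeff (fib_poly (2 * k + 1)) i * fib_moment i)"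
      using fib_poly_degree[of k] by (intro L) blast
    also have "\<dots> = (\<Sum>i<k. coeff (fib_poly (2 * k + 1)) i * fib_moment i) +
        coeff (fib_poly (2 * k + 1)) k * fib_moment k"
      by (simp only: lessThan_Suc_atMost[symmetric] sum.lessThan_Suc)
    finally show ?thesis
      using that fib_poly_degree[of k] fib_moment.simps[of k] by (simp del: fib_poly.simps)
  qed
  ultimately show "\<exists>L. is_fib_functional L" unfolding is_fib_functional_def by blast
next
  fix L M assume LM: "is_fib_functional L" "is_fib_functional M"
  then have lin: "Vector_Spaces.linear smult (*) L" "Vector_Spaces.linear smult (*) M"
    by (auto simp only: is_fib_functional_def)
  have eq: "L (fib_poly (2 * k + 1)) = M (fib_poly (2 * k + 1))" for k
  proof (cases "k = 0")
    case True
    then show ?thesis using LM by (simp add: is_fib_functional_def)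
  next
    case False
    then have "k \<ge> 1" by simp
    then show ?thesis using LM unfolding is_fib_functional_def by metis
  qed
  have "L (monom 1 k) = M (monom 1 k)" for k
  proof (induction k rule: less_induct)
    case (less k)
    have d: "degree (fib_poly (2 * k + 1)) \<le> k"
      using fib_poly_degree[of k] by blast
    have "(\<Sum>i\<le>k. coeff (fib_poly (2 * k + 1)) i * L (monom 1 i)) =
          (\<Sum>i\<le>k. coeff (fib_poly (2 * k + 1)) i * M (monom 1 i))"
      using eq[of k] linear_functional_eq_sum[OF lin(1) d] linear_functional_eq_sum[OF lin(2) d]
      by metis
    moreover have "(\<Sum>i<k. coeff (fib_poly (2 * k + 1)) i * L (monom 1 i)) =
          (\<Sum>i<k. coeff (fib_poly (2 * k + 1)) i * M (monom 1 i))"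
      by (rule sum.cong) (use less in auto)
    moreover have "coeff (fib_poly (2 * k + 1)) k = 1"
      using fib_poly_degree[of k] by blast
    ultimately show ?case
      by (simp only: lessThan_Suc_atMost[symmetric] sum.lessThan_Suc) simp
  qed
  then have "L p = M p" for p
    unfolding linear_functional_eq_sum[OF lin(1) order_refl, of p]
      linear_functional_eq_sum[OF lin(2) order_refl, of p] by (simp only:)
  then show "L = M" by (rule ext)
qed

text \<open>Row \<open>i\<close> sums row \<open>i - 1\<close> from the left if \<open>i\<close> is odd and from the right if \<open>i\<close> is even.\<close>

fun seidel_row :: "nat \<Rightarrow> int \<Rightarrow> int" where
  "seidel_row 0 j = 0"
| "seidel_row (Suc 0) j = (if j = 1 then 1 else 0)"
| "seidel_row (Suc (Suc m)) j =
     (if j \<le> 0 \<or> j > (int m + 3) div 2 then 0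
      else if even m then \<Sum>l\<in>{j..(int m + 3) div 2}. seidel_row (Suc m) l
      else \<Sum>l\<in>{1..j}. seidel_row (Suc m) l)"

lemma ceiling_half: "\<lceil>real i / 2\<rceil> = (int i + 1) div 2"
  by (cases "even i") (auto elim!: evenE oddE simp: ceiling_eq_iff)

lemma ex_seidel_genocchi: "\<exists>g. is_seidel_genocchi g"
proof
  have van: "seidel_row i j = 0" if "j \<le> 0 \<or> j > (int i + 1) div 2" for i j
    using that by (cases "(i, j)" rule: seidel_row.cases) auto
  have odd: "seidel_row (2 * i + 1) j = seidel_row (2 * i + 1) (j - 1) + seidel_row (2 * i) j"
    if "i \<ge> 1" "j \<in> {1..int i + 1}" for i j
  proof -
    from \<open>i \<ge> 1\<close> obtain m where i: "i = Suc m" by (cases i) auto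
    have "{1..j} = insert j {1..j - 1}" using that by auto
    then show ?thesis using that by (auto simp: i)
  qed
  have even: "seidel_row (2 * i) j = seidel_row (2 * i) (j + 1) + seidel_row (2 * i - 1) j"
    if "i \<ge> 1" "j \<in> {1..int i}" for i j
  proof -
    from \<open>i \<ge> 1\<close> obtain m where i: "i = Suc m" by (cases i) auto
    have "{j..int m + 1} = insert j {j + 1..int m + 1}" using that i by auto
    moreover have "(int (2 * m) + 3) div 2 = int m + 1" by simp
    ultimately show ?thesis using that by (auto simp: i)
  qed
  have "seidel_row 2 1 = 1" by (simp add: numeral_2_eq_2)
  then show "is_seidel_genocchi seidel_row"
    unfolding is_seidel_genocchi_def ceiling_half using van odd even by auto
qed

lemma seidel_genocchi_unique:
  assumes "is_seidel_genocchi g" "is_seidel_genocchi h" "i \<ge> 1"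
  shows "g i j = h i j"
  using assms(3)
proof (induction i arbitrary: j rule: less_induct)
  case (less i)
  have van: "g i j = 0 \<and> h i j = 0" if "j \<le> 0 \<or> j > (int i + 1) div 2" for j
    using assms(1,2) that less.prems unfolding is_seidel_genocchi_def ceiling_half by blast
  consider "i = 1" | m where "m \<ge> 1" "i = 2 * m + 1" | m where "m \<ge> 1" "i = 2 * m"
    using less.prems by (cases "even i") (auto elim!: evenE oddE, force)
  then show ?case
  proof cases
    case 1
    have "g 1 1 = h 1 1" using assms(1,2) by (simp add: is_seidel_genocchi_def)
    then show ?thesis using 1 van[of j] by (cases "j = 1"; cases "j < 1") auto
  next
    case 2
    have "g i (int k) = h i (int k)" for k
    proof (induction k)
      case 0 show ?case using van[of 0] by simp
    next
      case (Suc k)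
      show ?case
      proof (cases "int (Suc k) \<le> int m + 1")
        case True
        then have "int (Suc k) \<in> {1..int m + 1}" by simp
        then have "g i (int (Suc k)) = g i (int (Suc k) - 1) + g (2 * m) (int (Suc k))"
          "h i (int (Suc k)) = h i (int (Suc k) - 1) + h (2 * m) (int (Suc k))"
          using assms(1,2) 2 unfolding is_seidel_genocchi_def by blast+
        then show ?thesis using Suc less.IH[of "2 * m"] 2 by simp
      next
        case False
        then show ?thesis using van[of "int (Suc k)"] 2 by auto
      qed
    qed
    from this[of "nat j"] show ?thesis using van[of j] by (cases "j \<ge> 0") auto
  next
    case 3
    have "g i (int m + 1 - int k) = h i (int m + 1 - int k)" for k
    proof (induction k)
      case 0 show ?case using van[of "int m + 1"] 3 by simp
    next
      case (Suc k)
      define j where "j = int m + 1 - int (Suc k)"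
      show ?case
      proof (cases "j \<ge> 1")
        case True
        then have "j \<in> {1..int m}" by (simp add: j_def)
        then have "g i j = g i (j + 1) + g (2 * m - 1) j" "h i j = h i (j + 1) + h (2 * m - 1) j"
          using assms(1,2) 3 unfolding is_seidel_genocchi_def by blast+
        then show ?thesis using Suc less.IH[of "2 * m - 1"] 3 by (simp add: j_def algebra_simps)
      next
        case False
        then show ?thesis using van[of j] by (auto simp: j_def)
      qed
    qed
    from this[of "nat (int m + 1 - j)"] show ?thesis
      using van[of j] 3 by (cases "j \<le> int m + 1") auto
  qed
qed

end

theory Submission
  imports Defs
begin

text \<open>Up to the sign \<open>(-1)\<^sup>n\<close>, the two recurrences of the triangle are the images under \<open>L\<close> of the
  Fibonacci recurrence multiplied by a power of \<open>s\<close>. The even rows are filled from the right,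
  starting from the entry in column \<open>n + 1\<close>, which vanishes because \<open>L (F\<^bsub>2n+1\<^esub>) = 0\<close>;
  the odd rows are filled from the left, starting from \<open>F\<^sub>0 = 0\<close>.\<close>

lemma seidel_even_row_from_odd:
  assumes g: "is_seidel_genocchi g" and L: "is_fib_functional L"
    and n: "n \<ge> 1" and k: "k \<in> {1..n + 1}"
    and odd: "\<And>k. k \<in> {1..n} \<Longrightarrow> of_int (g (2 * n - 1) (int k)) =
      (-1) ^ (n - 1) * L ([:0, 1:] ^ (n - k) * fib_poly (2 * k))"
  shows "of_int (g (2 * n) (int k)) = (-1) ^ n * L ([:0, 1:] ^ (n + 1 - k) * fib_poly (2 * k - 1))"
proof -
  have add: "L (p + q) = L p + L q" for p q
    using L by (simp add: is_fib_functional_def linear_functional_iff)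
  from k have "k \<le> n + 1" by simp
  then show ?thesis
    using k
  \<comment> \<open>Downward induction on \<open>k\<close>, following the right-to-left filling. In
    column \<open>n + 1\<close>, just outside the row, the power of \<open>s\<close> is 1 and the
    index \<open>2 * k - 1\<close> equals \<open>2 * n + 1\<close>.\<close>
  proof (induction rule: inc_induct)
    case base
    have "L (fib_poly (2 * n + 1)) = 0"
      using L n unfolding is_fib_functional_def by blast
    moreover have "g (2 * n) (int (n + 1)) = 0"
      using g n unfolding is_seidel_genocchi_def by simp
    ultimately show ?case by simp
  next
    case (step k)
    then have k: "k \<ge> 1" "k \<le> n" by auto
    have "int k \<in> {1..int n}" using k by auto
    then have rec: "g (2 * n) (int k) = g (2 * n) (int (Suc k)) + g (2 * n - 1) (int k)"
      using g n unfolding is_seidel_genocchi_def by (simp add: add.commute)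
    have pow: "[:0, 1:] ^ (n + 1 - k) = [:0, 1:] * ([:0, 1:] :: complex poly) ^ (n - k)"
      using k by (simp add: Suc_diff_le)
    have "fib_poly (2 * k + 1) = fib_poly (2 * k) + [:0, 1:] * fib_poly (2 * k - 1)"
      using k by (cases k) auto
    then have "[:0, 1:] ^ (n - k) * fib_poly (2 * k + 1) =
        [:0, 1:] ^ (n - k) * fib_poly (2 * k) + [:0, 1:] ^ (n + 1 - k) * fib_poly (2 * k - 1)"
      by (simp only: pow) (simp only: distrib_left ac_simps)
    then have fib: "L ([:0, 1:] ^ (n - k) * fib_poly (2 * k + 1)) =
        L ([:0, 1:] ^ (n - k) * fib_poly (2 * k)) +
        L ([:0, 1:] ^ (n + 1 - k) * fib_poly (2 * k - 1))"
      by (simp only: add)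
    have next_entry: "of_int (g (2 * n) (int (Suc k))) =
        (-1) ^ n * L ([:0, 1:] ^ (n - k) * fib_poly (2 * k + 1))"
      using step.IH k by (simp del: fib_poly.simps)
    \<comment> \<open>Row \<open>2 * n - 1\<close> carries the opposite sign, so the sum in the
      recurrence becomes the difference of \<open>L\<close> at \<open>s^(n-k) F_{2k+1}\<close> and
      at \<open>s^(n-k) F_{2k}\<close>. By \<open>fib\<close> this is the required value.\<close>
    have "(-1 :: complex) ^ n = - ((-1) ^ (n - 1))"
      using n by (cases n) auto
    then show ?case
      using odd[of k] k
      unfolding rec of_int_add next_entry fib by (simp add: algebra_simps del: fib_poly.simps)
  qed
qed

text \<open>Both rows carry the sign \<open>(-1) ^ n\<close>, so
  \<open>F_{2k} = F_{2k-1} + s F_{2k-2}\<close> times \<open>s^(n+1-k)\<close> matches the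
  recurrence term by term. The assumption on row \<open>2 * n\<close> includes its zero entry in
  column \<open>n + 1\<close>, because the last entry of row \<open>2 * n + 1\<close> adds
  it.\<close>

lemma seidel_odd_row_from_even:
  assumes g: "is_seidel_genocchi g" and L: "is_fib_functional L"
    and n: "n \<ge> 1" and k: "k \<le> n + 1"
    and even: "\<And>k. k \<in> {1..n + 1} \<Longrightarrow> of_int (g (2 * n) (int k)) =
      (-1) ^ n * L ([:0, 1:] ^ (n + 1 - k) * fib_poly (2 * k - 1))"
  shows "of_int (g (2 * n + 1) (int k)) = (-1) ^ n * L ([:0, 1:] ^ (n + 1 - k) * fib_poly (2 * k))"
proof -
  have add: "L (p + q) = L p + L q" and scale: "L (smult c p) = c * L p" for p q c
    using L by (simp_all add: is_fib_functional_def linear_functional_iff)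
  show ?thesis
    using k
  proof (induction k)
    case 0
    have "g (2 * n + 1) 0 = 0" using g unfolding is_seidel_genocchi_def by simp
    \<comment> \<open>Column 0 lies outside the triangle; the instance of \<open>scale\<close> gives
      \<open>L 0 = 0\<close>, which covers \<open>F_0 = 0\<close>.\<close>
    then show ?case using scale[of 0 0] by simp
  next
    case (Suc k)
    then have k: "k \<le> n" by simp
    have "int (Suc k) \<in> {1..int n + 1}" using k by auto
    then have "g (2 * n + 1) (int (Suc k)) =
        g (2 * n + 1) (int (Suc k) - 1) + g (2 * n) (int (Suc k))"
      using g n unfolding is_seidel_genocchi_def by blast
    then have rec: "g (2 * n + 1) (int (Suc k)) =
        g (2 * n + 1) (int k) + g (2 * n) (int (Suc k))"
      by simp
    have pow: "[:0, 1:] ^ (n + 1 - k) = [:0, 1:] * ([:0, 1:] :: complex poly) ^ (n + 1 - Suc k)"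
      using k by (simp add: Suc_diff_le)
    have "fib_poly (2 * Suc k) = fib_poly (2 * Suc k - 1) + [:0, 1:] * fib_poly (2 * k)"
      by simp
    then have "[:0, 1:] ^ (n + 1 - Suc k) * fib_poly (2 * Suc k) =
        [:0, 1:] ^ (n + 1 - Suc k) * fib_poly (2 * Suc k - 1) +
        [:0, 1:] ^ (n + 1 - k) * fib_poly (2 * k)"
      by (simp only: pow) (simp only: distrib_left ac_simps)
    then have fib: "L ([:0, 1:] ^ (n + 1 - Suc k) * fib_poly (2 * Suc k)) =
        L ([:0, 1:] ^ (n + 1 - Suc k) * fib_poly (2 * Suc k - 1)) +
        L ([:0, 1:] ^ (n + 1 - k) * fib_poly (2 * k))"
      by (simp only: add)
    have prev: "of_int (g (2 * n + 1) (int k)) =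
        (-1) ^ n * L ([:0, 1:] ^ (n + 1 - k) * fib_poly (2 * k))"
      using Suc.IH k by simp
    have even': "of_int (g (2 * n) (int (Suc k))) =
        (-1) ^ n * L ([:0, 1:] ^ (n + 1 - Suc k) * fib_poly (2 * Suc k - 1))"
      by (rule even) (use k in auto)
    show ?case
      unfolding rec of_int_add prev even' fib by (simp only: distrib_left add.commute)
  qed
qed

text \<open>Each induction step passes through the even row in between. The base case is where the
  normalisations \<open>g 1 1 = 1\<close> and \<open>L (F_1) = 1\<close> meet, since
  \<open>F_2 = F_1 = 1\<close>.\<close>

lemma seidel_odd_row:
  assumes g: "is_seidel_genocchi g" and L: "is_fib_functional L"
  shows "k \<in> {1..n + 1} \<Longrightarrow> of_int (g (2 * n + 1) (int k)) =
    (-1) ^ n * L ([:0, 1:] ^ (n + 1 - k) * fib_poly (2 * k))"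
proof (induction n arbitrary: k)
  case 0
  then have "k = 1" by simp
  moreover have "g 1 1 = 1" "L 1 = 1"
    using g L by (simp_all add: is_seidel_genocchi_def is_fib_functional_def)
  ultimately show ?case by (simp add: numeral_2_eq_2)
next
  case (Suc n)
  have odd: "of_int (g (2 * Suc n - 1) (int k)) =
      (-1) ^ (Suc n - 1) * L ([:0, 1:] ^ (Suc n - k) * fib_poly (2 * k))"
    if "k \<in> {1..Suc n}" for k
    using Suc.IH[of k] that by simp
  show ?case
  proof (rule seidel_odd_row_from_even[OF g L])
    show "of_int (g (2 * Suc n) (int k)) =
        (-1) ^ Suc n * L ([:0, 1:] ^ (Suc n + 1 - k) * fib_poly (2 * k - 1))"
      if "k \<in> {1..Suc n + 1}" for k
      by (rule seidel_even_row_from_odd[OF g L _ that odd]) simp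
  qed (use Suc.prems in auto)
qed

theorem theorem3p1:
  fixes g :: "nat \<Rightarrow> int \<Rightarrow> int" and L :: "complex poly \<Rightarrow> complex"
  assumes "is_seidel_genocchi g" and "is_fib_functional L"
  shows "(\<forall>n::nat. n \<ge> 1 \<longrightarrow> (\<forall>k\<in>{1..n}.
            of_int (g (2 * n) (int k)) =
              (-1) ^ n * L ([:0, 1:] ^ (n + 1 - k) * fib_poly (2 * k - 1)))) \<and>
         (\<forall>n::nat. \<forall>k\<in>{1..n + 1}.
            of_int (g (2 * n + 1) (int k)) =
              (-1) ^ n * L ([:0, 1:] ^ (n + 1 - k) * fib_poly (2 * k)))"
proof (intro conjI allI impI ballI)
  fix n k :: nat
  assume n: "n \<ge> 1" and k: "k \<in> {1..n}"
  \<comment> \<open>As \<open>n \<ge> 1\<close>, row \<open>2 * n - 1\<close> is the odd row with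
    parameter \<open>n - 1\<close>, so the even rows follow from the odd ones without a further
    induction on \<open>n\<close>.\<close>
  have odd: "of_int (g (2 * n - 1) (int k)) =
      (-1) ^ (n - 1) * L ([:0, 1:] ^ (n - k) * fib_poly (2 * k))" if "k \<in> {1..n}" for k
    using seidel_odd_row[OF assms, of k "n - 1"] n that by (cases n) auto
  show "of_int (g (2 * n) (int k)) =
      (-1) ^ n * L ([:0, 1:] ^ (n + 1 - k) * fib_poly (2 * k - 1))"
    using seidel_even_row_from_odd[OF assms n _ odd] k by simp
qed (rule seidel_odd_row[OF assms])

end
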